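(* Let $k\in\mathbb{C}$ with $k\neq 0,-2$, and specialize the parameters of the deformed Virasoro algebra to $$q=e^{h},\qquad t=-q^{\frac{k+2}{2}}\ \bigl(=-e^{\frac{(k+2)h}{2}}\bigr),\qquad p=q/t .$$ Suppose that the current $T(\zeta)=\sum_{n\in\mathbb{Z}}T_n\zeta^{-n}$ of the deformed Virasoro algebra with these parameters has, as $h\to0$, an expansion of the form $$T(\zeta)=0+h\,T^{(1)}(\zeta)+h^2\,T^{(2)}(\zeta)+\cdots .$$ Then, at second order in $h$, the defining relation of the deformed Virasoro algebra reduces to the relation of Lepowsky–Wilson's $\mathcal{Z}$-algebra at level $k$ for $z(\zeta)=\sqrt{-1}\,T^{(1)}(\zeta)$; that is, $$\left(\frac{\zeta_1-\zeta_2}{\zeta_1+\zeta_2}\right)^{2/k}z(\zeta_1)z(\zeta_2)=\left(\frac{\zeta_2-\zeta_1}{\zeta_2+\zeta_1}\right)^{2/k}z(\zeta_2)z(\zeta_1)+k\,(D\delta)\left(-\frac{\zeta_2}{\zeta_1}\right).$$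
   Context: **Notation.** $\delta(\zeta)=\sum_{m\in\mathbb{Z}}\zeta^m$, $D=\zeta\frac{d}{d\zeta}$, so $(D\delta)(-\zeta_2/\zeta_1)=\sum_{m\in\mathbb{Z}}m\,(-\zeta_2/\zeta_1)^m$. **Deformed Virasoro algebra.** With parameters $q,t$ and $p=q/t$, it is the associative algebra generated by $T_n$ ($n\in\mathbb{Z}$) with defining relations, for $T(\zeta)=\sum_{n\in\mathbb{Z}}T_n\zeta^{-n}$, $$f(\zeta_2/\zeta_1)T(\zeta_1)T(\zeta_2)-T(\zeta_2)T(\zeta_1)f(\zeta_1/\zeta_2)=-\frac{(1-q)(1-t^{-1})}{1-p}\left[\delta\left(\frac{p\zeta_2}{\zeta_1}\right)-\delta\left(\frac{p^{-1}\zeta_2}{\zeta_1}\right)\right],$$ where $$f(\zeta)=\exp\left\{\sum_{n\ge1}\frac1n\frac{(1-q^n)(1-t^{-n})}{1+p^n}\zeta^n\right\}$$ is a power series in $\zeta$. **Conventions.** All relations are identities of formal series in $\zeta_1^{\pm1},\zeta_2^{\pm1}$. The function $\left(\frac{\zeta_1-\zeta_2}{\zeta_1+\zeta_2}\right)^{2/k}=\left(\frac{1-\zeta_2/\zeta_1}{1+\zeta_2/\zeta_1}\right)^{2/k}$ is expanded as a power series in $\zeta_2/\zeta_1$ with constant term $1$, and $\left(\frac{\zeta_2-\zeta_1}{\zeta_2+\zeta_1}\right)^{2/k}$ as a power series in $\zeta_1/\zeta_2$ with constant term $1$. The expansion in $h$ is understood coefficientwise: $T_n=\sum_{i\ge1}h^iT^{(i)}_n$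 with $T^{(i)}(\zeta)=\sum_{n}T^{(i)}_n\zeta^{-n}$, where the $T^{(i)}_n$ are operators independent of $h$ on a vector space such that, for every vector $v$ and every $i$, $T^{(i)}_nv=0$ for all sufficiently large $n$; thus the infinite sums of products of modes appearing in the relations are finite on each vector. *)

theory Defs
  imports
    Complex_Main
    "HOL-Computational_Algebra.Formal_Power_Series"
    "HOL-Library.Groups_Big_Fun"
begin

section \<open>Formal series\<close>

text \<open>
  A bilateral formal series \<open>g(x) = \<Sum>m\<in>\<int>. g m * x^m\<close> is its coefficient function.
  A formal series in \<open>\<zeta>1, \<zeta>2\<close> is the function whose value at \<open>a b\<close> is the coefficient of
  \<open>\<zeta>1^(-a) * \<zeta>2^(-b)\<close>, which matches the mode convention \<open>A(\<zeta>) = \<Sum>n\<in>\<int>. A n * \<zeta>^(-n)\<close>.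
\<close>

definition delta :: "int \<Rightarrow> 'a::one" where
  "delta m = 1"

definition euler_D :: "(int \<Rightarrow> 'a::ring_1) \<Rightarrow> int \<Rightarrow> 'a" where
  "euler_D g m = of_int m * g m"

text \<open>\<open>dilate c g\<close> is the series \<open>g(c x)\<close>, for invertible \<open>c\<close>.\<close>

definition dilate :: "'a::{inverse,power} \<Rightarrow> (int \<Rightarrow> 'a) \<Rightarrow> int \<Rightarrow> 'a" where
  "dilate c g m = c powi m * g m"

text \<open>The substitution \<open>x = \<zeta>2 / \<zeta>1\<close>; note \<open>x^m = \<zeta>1^(-m) * \<zeta>2^(-(-m))\<close>.\<close>

definition at_ratio :: "(int \<Rightarrow> 'a::zero) \<Rightarrow> int \<Rightarrow> int \<Rightarrow> 'a" where
  "at_ratio g a b = (if a + b = 0 then g a else 0)"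

text \<open>
  The exponential of a power series without constant term. The library's \<open>fps_exp\<close> needs
  coefficients in a field, whereas here they lie in \<open>\<complex>[[h]]\<close>.
\<close>

definition exp_series :: "complex fps fps \<Rightarrow> complex fps fps" where
  "exp_series G = Abs_fps (\<lambda>j. fps_const (inverse (fact j))) oo G"

text \<open>\<open>g^c\<close> for a power series \<open>g\<close> with constant term \<open>1\<close>, again with constant term \<open>1\<close>.\<close>

definition fps_cpower :: "complex fps \<Rightarrow> complex \<Rightarrow> complex fps" where
  "fps_cpower g c = fps_binomial c oo (g - 1)"

section \<open>Series in \<open>h\<close> with coefficients in a vector space\<close>

text \<open>
  For a complex vector space \<open>V\<close> with scalar multiplication \<open>scale\<close>, the type \<open>'v fps\<close> is
  \<open>V[[h]]\<close>, and \<open>hscale\<close> is its \<open>\<complex>[[h]]\<close>-module structure.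
\<close>

definition hscale ::
  "(complex \<Rightarrow> 'v::ab_group_add \<Rightarrow> 'v) \<Rightarrow> complex fps \<Rightarrow> 'v fps \<Rightarrow> 'v fps" where
  "hscale scale c w = Abs_fps (\<lambda>N. \<Sum>i=0..N. scale (fps_nth c i) (fps_nth w (N - i)))"

text \<open>
  An infinite sum in \<open>V[[h]]\<close> is formed coefficientwise in \<open>h\<close>; each coefficient is a sum with
  finitely many nonzero terms in the situation of interest (see \<open>finite_support_current_product\<close>).
\<close>

definition hsum :: "(nat \<Rightarrow> 'v::ab_group_add fps) \<Rightarrow> 'v fps" where
  "hsum g = Abs_fps (\<lambda>N. Sum_any (\<lambda>l. fps_nth (g l) N))"

text \<open>
  \<open>T(\<zeta>) = h T1(\<zeta>) + h^2 T2(\<zeta>) + \<dots>\<close>: the modes \<open>T n\<close> act \<open>\<complex>[[h]]\<close>-linearly on \<open>V[[h]]\<close>,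
  and \<open>Tc i n\<close> is the coefficient of \<open>h^i\<close> in \<open>T n\<close>. Only \<open>i \<ge> 1\<close> matters.
\<close>

definition h_expansion ::
  "(int \<Rightarrow> 'v::ab_group_add fps \<Rightarrow> 'v fps) \<Rightarrow> (nat \<Rightarrow> int \<Rightarrow> 'v \<Rightarrow> 'v) \<Rightarrow> bool" where
  "h_expansion T Tc \<longleftrightarrow>
     (\<forall>n w. T n w = Abs_fps (\<lambda>N. \<Sum>i=1..N. Tc i n (fps_nth w (N - i))))"

definition smooth :: "(int \<Rightarrow> 'v::zero \<Rightarrow> 'v) \<Rightarrow> bool" where
  "smooth A \<longleftrightarrow> (\<forall>v. \<exists>n0. \<forall>n\<ge>n0. A n v = 0)"

section \<open>The deformed Virasoro algebra\<close>

text \<open>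
  The parameters \<open>q, t\<close> are elements of \<open>\<complex>[[h]]\<close>. The quotient by \<open>1 + p^n\<close> is the division of
  \<open>\<complex>[[h]]\<close>: \<open>1 + p^n\<close> may vanish at \<open>h = 0\<close>, but the quotient used below is exact
  (see \<open>dv_quotient_exact\<close>).
\<close>

definition dv_f :: "complex fps \<Rightarrow> complex fps \<Rightarrow> complex fps fps" where
  "dv_f q t = (let p = q / t in exp_series (Abs_fps (\<lambda>n. if n = 0 then 0 else
      fps_const (1 / of_nat n) * ((1 - q ^ n) * (1 - inverse t ^ n) / (1 + p ^ n)))))"

text \<open>
  \<open>f(\<zeta>2/\<zeta>1) T(\<zeta>1) T(\<zeta>2)\<close>, applied to \<open>w\<close>. Exchanging \<open>a\<close> and \<open>b\<close> gives
  \<open>f(\<zeta>1/\<zeta>2) T(\<zeta>2) T(\<zeta>1)\<close>.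
\<close>

definition dv_product ::
  "(complex \<Rightarrow> 'v::ab_group_add \<Rightarrow> 'v) \<Rightarrow> complex fps fps \<Rightarrow>
   (int \<Rightarrow> 'v fps \<Rightarrow> 'v fps) \<Rightarrow> int \<Rightarrow> int \<Rightarrow> 'v fps \<Rightarrow> 'v fps" where
  "dv_product scale f T a b w =
     hsum (\<lambda>l. hscale scale (fps_nth f l) (T (a - int l) (T (b + int l) w)))"

definition dv_lhs ::
  "(complex \<Rightarrow> 'v::ab_group_add \<Rightarrow> 'v) \<Rightarrow> complex fps \<Rightarrow> complex fps \<Rightarrow>
   (int \<Rightarrow> 'v fps \<Rightarrow> 'v fps) \<Rightarrow> int \<Rightarrow> int \<Rightarrow> 'v fps \<Rightarrow> 'v fps" where
  "dv_lhs scale q t T a b w =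
     dv_product scale (dv_f q t) T a b w - dv_product scale (dv_f q t) T b a w"

definition dv_rhs :: "complex fps \<Rightarrow> complex fps \<Rightarrow> int \<Rightarrow> int \<Rightarrow> complex fps" where
  "dv_rhs q t a b = (let p = q / t in
     - ((1 - q) * (1 - inverse t) / (1 - p)) *
       (at_ratio (dilate p delta) a b - at_ratio (dilate (inverse p) delta) a b))"

definition deformed_virasoro ::
  "(complex \<Rightarrow> 'v::ab_group_add \<Rightarrow> 'v) \<Rightarrow> complex fps \<Rightarrow> complex fps \<Rightarrow>
   (int \<Rightarrow> 'v fps \<Rightarrow> 'v fps) \<Rightarrow> bool" where
  "deformed_virasoro scale q t T \<longleftrightarrow>
     (\<forall>a b w. dv_lhs scale q t T a b w = hscale scale (dv_rhs q t a b) w)"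

text \<open>
  The coefficient of \<open>h^N\<close> in the defining relation, as an identity of operators on \<open>V\<close>
  (embedded in \<open>V[[h]]\<close> as the constants).
\<close>

definition deformed_virasoro_at_order ::
  "nat \<Rightarrow> (complex \<Rightarrow> 'v::ab_group_add \<Rightarrow> 'v) \<Rightarrow> complex fps \<Rightarrow> complex fps \<Rightarrow>
   (int \<Rightarrow> 'v fps \<Rightarrow> 'v fps) \<Rightarrow> bool" where
  "deformed_virasoro_at_order N scale q t T \<longleftrightarrow>
     (\<forall>a b v. fps_nth (dv_lhs scale q t T a b (fps_const v)) N =
               fps_nth (hscale scale (dv_rhs q t a b) (fps_const v)) N)"

section \<open>The Lepowsky--Wilson algebra\<close>

text \<open>\<open>g(\<zeta>2/\<zeta>1) z(\<zeta>1) z(\<zeta>2)\<close>, applied to \<open>v\<close>.\<close>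

definition z_product ::
  "(complex \<Rightarrow> 'v::ab_group_add \<Rightarrow> 'v) \<Rightarrow> complex fps \<Rightarrow>
   (int \<Rightarrow> 'v \<Rightarrow> 'v) \<Rightarrow> int \<Rightarrow> int \<Rightarrow> 'v \<Rightarrow> 'v" where
  "z_product scale g z a b v =
     Sum_any (\<lambda>l. scale (fps_nth g l) (z (a - int l) (z (b + int l) v)))"

definition z_factor :: "complex \<Rightarrow> complex fps" where
  "z_factor k = fps_cpower ((1 - fps_X) / (1 + fps_X)) (2 / k)"

definition z_algebra_relation ::
  "(complex \<Rightarrow> 'v::ab_group_add \<Rightarrow> 'v) \<Rightarrow> complex \<Rightarrow> (int \<Rightarrow> 'v \<Rightarrow> 'v) \<Rightarrow> bool" where
  "z_algebra_relation scale k z \<longleftrightarrow>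
     (\<forall>a b v. z_product scale (z_factor k) z a b v =
        z_product scale (z_factor k) z b a v
        + scale (k * at_ratio (dilate (- 1) (euler_D delta)) a b) v)"

section \<open>Well-definedness\<close>

lemma finite_support_z_product:
  assumes "vector_space scale" and "\<And>n. Vector_Spaces.linear scale scale (z n)" and "smooth z"
  shows "finite {l. scale (fps_nth g l) (z (a - int l) (z (b + int l) v)) \<noteq> 0}"
proof -
  interpret vector_space scale by fact
  from assms(3) obtain n0 where n0: "\<And>n. n \<ge> n0 \<Longrightarrow> z n v = 0"
    unfolding smooth_def by blast
  have z0: "z n 0 = 0" for n
    by (rule module_hom.zero[OF Vector_Spaces.linear.axioms(3)[OF assms(2)]])
  have "{l. scale (fps_nth g l) (z (a - int l) (z (b + int l) v)) \<noteq> 0} \<subseteq> {..nat (n0 - b)}"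
  proof
    fix l assume l: "l \<in> {l. scale (fps_nth g l) (z (a - int l) (z (b + int l) v)) \<noteq> 0}"
    then have "z (b + int l) v \<noteq> 0" using z0 by auto
    then have "b + int l < n0" using n0 by (meson not_le)
    then show "l \<in> {..nat (n0 - b)}" by simp
  qed
  then show ?thesis by (rule finite_subset) simp
qed

lemma finite_support_current_product:
  assumes "vector_space scale"
    and lin: "\<And>i n. i \<ge> 1 \<Longrightarrow> Vector_Spaces.linear scale scale (Tc i n)"
    and sm: "\<And>i. i \<ge> 1 \<Longrightarrow> smooth (Tc i)"
    and ex: "h_expansion T Tc"
  shows "finite {l. fps_nth (hscale scale (fps_nth f l) (T (a - int l) (T (b + int l) w))) N \<noteq> 0}"
proof -
  interpret vector_space scale by fact
  have z0: "Tc i n 0 = 0" if "i \<ge> 1" for i n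
    by (rule module_hom.zero[OF Vector_Spaces.linear.axioms(3)[OF lin[OF that]]])
  have "\<forall>i\<in>{1..N}. \<forall>j\<in>{..N}. \<exists>n0. \<forall>n\<ge>n0. Tc i n (fps_nth w j) = 0"
    using sm unfolding smooth_def by auto
  then obtain n0 where n0: "\<And>i j n. i \<in> {1..N} \<Longrightarrow> j \<in> {..N} \<Longrightarrow> n \<ge> n0 i j \<Longrightarrow>
      Tc i n (fps_nth w j) = 0"
    by metis
  define S where "S = insert 0 ((\<lambda>(i, j). n0 i j) ` ({1..N} \<times> {..N}))"
  have fS: "finite S" unfolding S_def by simp
  have van: "fps_nth (T n w) M = 0" if "n \<ge> Max S" "M \<le> N" for n M
  proof -
    have "Tc i n (fps_nth w (M - i)) = 0" if i: "i \<in> {1..M}" for i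
    proof (rule n0)
      show "i \<in> {1..N}" "M - i \<in> {..N}" using i \<open>M \<le> N\<close> by auto
      then have "n0 i (M - i) \<in> S" unfolding S_def by (auto intro!: image_eqI[of _ _ "(i, M - i)"])
      then show "n0 i (M - i) \<le> n" using Max_ge[OF fS] \<open>n \<ge> Max S\<close> by (meson order_trans)
    qed
    then show ?thesis using ex unfolding h_expansion_def by simp
  qed
  have TT: "fps_nth (T m (T n w)) M = 0" if "n \<ge> Max S" "M \<le> N" for m n M
  proof -
    have "Tc i m (fps_nth (T n w) (M - i)) = 0" if "i \<in> {1..M}" for i
      using van[of n "M - i"] z0[of i m] that \<open>n \<ge> Max S\<close> \<open>M \<le> N\<close> by simp
    then have "(\<Sum>i=1..M. Tc i m (fps_nth (T n w) (M - i))) = 0" by (intro sum.neutral) blast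
    moreover have "fps_nth (T m u) M = (\<Sum>i=1..M. Tc i m (fps_nth u (M - i)))" for u
      using ex unfolding h_expansion_def by simp
    ultimately show ?thesis by simp
  qed
  have "{l. fps_nth (hscale scale (fps_nth f l) (T (a - int l) (T (b + int l) w))) N \<noteq> 0}
      \<subseteq> {..nat (Max S - b)}"
  proof
    fix l
    assume l: "l \<in> {l. fps_nth (hscale scale (fps_nth f l) (T (a - int l) (T (b + int l) w))) N \<noteq> 0}"
    have "\<not> b + int l \<ge> Max S"
    proof
      assume "b + int l \<ge> Max S"
      then have "fps_nth (hscale scale (fps_nth f l) (T (a - int l) (T (b + int l) w))) N = 0"
        by (simp add: hscale_def TT)
      with l show False by simp
    qed
    then show "l \<in> {..nat (Max S - b)}" by simp
  qed
  then show ?thesis by (rule finite_subset) simp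
qed

lemma dv_quotient_exact:
  fixes k :: complex and n :: nat
  assumes "k \<noteq> 0" and "n \<ge> 1"
  defines "q \<equiv> fps_exp 1" and "t \<equiv> - fps_exp ((k + 2) / 2)"
  shows "1 + (q / t) ^ n \<noteq> 0 \<and> 1 + (q / t) ^ n dvd (1 - q ^ n) * (1 - inverse t ^ n)"
proof -
  have it: "inverse t = - fps_exp (- ((k + 2) / 2))"
    unfolding t_def by (simp add: fps_exp_neg)
  have "q / t = q * inverse t"
    unfolding t_def by (rule fps_divide_unit) simp
  also have "\<dots> = - (fps_exp 1 * fps_exp (- ((k + 2) / 2)))" unfolding it q_def by simp
  also have "\<dots> = - fps_exp (- (k / 2))"
    unfolding fps_exp_add_mult[symmetric] by (simp add: field_simps)
  finally have p: "q / t = - fps_exp (- (k / 2))" .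
  have pn: "(q / t) ^ n = fps_const ((-1) ^ n) * fps_exp (of_nat n * - (k / 2))"
  proof -
    have "(- 1 :: complex fps) = fps_const (- 1)" by (simp flip: fps_const_neg)
    then show ?thesis
      unfolding p power_minus[of "fps_exp (- (k / 2))"] fps_exp_power_mult by (simp only: fps_const_power)
  qed
  have n1: "fps_nth (1 + (q / t) ^ n) 1 = (-1) ^ n * (of_nat n * - (k / 2))"
    unfolding pn by simp
  with assms have nz: "fps_nth (1 + (q / t) ^ n) 1 \<noteq> 0" by simp
  then have ne: "1 + (q / t) ^ n \<noteq> 0" by (metis fps_zero_nth)
  have sd: "subdegree (1 + (q / t) ^ n) \<le> 1" using nz by (rule subdegree_leI)
  have z: "fps_nth ((1 - q ^ n) * (1 - inverse t ^ n)) 0 = 0"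
    unfolding q_def by (simp add: fps_exp_power_mult)
  have "1 + (q / t) ^ n dvd G" if G: "fps_nth G 0 = 0" for G :: "complex fps"
  proof (cases "G = 0")
    case False
    then have "1 \<le> subdegree G" using G by (intro subdegree_geI) auto
    with sd show ?thesis using fps_dvd_iff[OF ne False] by linarith
  qed simp
  from this[OF z] have "1 + (q / t) ^ n dvd (1 - q ^ n) * (1 - inverse t ^ n)" .
  with ne show ?thesis by blast
qed

end

theory Submission
  imports Defs
begin

text \<open>
  Since \<open>T(\<zeta>)\<close> starts at order \<open>h\<close>, the product \<open>T(\<zeta>1) T(\<zeta>2)\<close> starts at order \<open>h^2\<close> with
  \<open>T1(\<zeta>1) T1(\<zeta>2)\<close>. So the coefficient of \<open>h^2\<close> in the defining relation involves only
  \<open>T1\<close>, the value of \<open>f\<close> at \<open>h = 0\<close>, and the coefficient of \<open>h^2\<close> on the right-hand side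
  (\<open>fps_nth_dv_lhs_2\<close>). Both are computed from \<open>p = - e^(- k h / 2)\<close>.

  In \<open>log f\<close>, the factor \<open>1 - q^n\<close> has a simple zero at \<open>h = 0\<close>. For even \<open>n\<close> the denominator
  \<open>1 + p^n\<close> tends to \<open>2\<close> and the term disappears. For odd \<open>n\<close> the denominator has a
  simple zero as well, because \<open>p\<close> tends to \<open>-1\<close>, while \<open>1 - t^(-n)\<close> tends to \<open>2\<close>; the limit is
  \<open>- 4 / k\<close>. Summing over odd \<open>n\<close> gives
  \<open>- (4 / k) \<Sum> \<zeta>^n / n = (2 / k) log ((1 - \<zeta>) / (1 + \<zeta>))\<close>, the logarithm of the
  Lepowsky--Wilson factor (\<open>dv_f_at_h_zero\<close>).

  On the right, the two delta functions coincide at \<open>h = 0\<close>, so their difference is of order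
  \<open>h\<close> and gives the derivative of \<open>\<delta>\<close> at \<open>- \<zeta>2 / \<zeta>1\<close>; the prefactor is of order
  \<open>h\<close> too (\<open>dv_rhs_order_2\<close>). Finally \<open>z = \<i> T1\<close> turns \<open>T1 T1\<close> into \<open>- z z\<close>.
\<close>

section \<open>Powers and exponentials of power series\<close>

text \<open>
  Setting \<open>h = 0\<close> is a ring homomorphism \<open>\<complex>[[h]] \<rightarrow> \<complex>\<close>, so applied to each coefficient it
  commutes with powers, and hence with composition.
\<close>

lemma fps_nth_nth_power_0:
  fixes G :: "complex fps fps"
  shows "fps_nth (fps_nth (G ^ i) n) 0 = fps_nth (Abs_fps (\<lambda>l. fps_nth (fps_nth G l) 0) ^ i) n"
proof (induction i arbitrary: n)
  case 0
  show ?case by simp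
next
  case (Suc i)
  then show ?case by (simp add: fps_mult_nth fps_sum_nth)
qed

lemma fps_nth_nth_exp_series_0:
  "fps_nth (fps_nth (exp_series G) n) 0 =
     fps_nth (fps_exp 1 oo Abs_fps (\<lambda>l. fps_nth (fps_nth G l) 0)) n"
  by (simp add: exp_series_def fps_compose_nth fps_sum_nth fps_nth_nth_power_0 inverse_eq_divide)

text \<open>
  The hypothesis on derivatives reads \<open>L' = c * g' / g\<close>, so \<open>L\<close> is \<open>c * log g\<close>.
  The proof shows that \<open>g^c * e^(-L)\<close> has derivative zero.
\<close>

lemma fps_exp_compose_eq_fps_cpower:
  fixes g L :: "complex fps"
  assumes g0: "fps_nth g 0 = 1" and L0: "fps_nth L 0 = 0"
    and ode: "fps_deriv L * g = fps_const c * fps_deriv g"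
  shows "fps_exp 1 oo L = fps_cpower g c"
proof -
  define B where "B = fps_cpower g c"
  define G where "G = fps_exp (- 1) oo L"
  have g1: "fps_nth (g - 1) 0 = 0" using g0 by simp
  have X: "fps_X oo (g - 1) = g - 1" by (rule fps_X_fps_compose_startby0[OF g1])
  have "(1 + fps_X) * fps_deriv (fps_binomial c) = fps_const c * fps_binomial c"
    by (simp add: fps_binomial_deriv fps_divide_unit mult.left_commute[of "1 + fps_X"]
        inverse_mult_eq_1')
  then have "((1 + fps_X) * fps_deriv (fps_binomial c)) oo (g - 1)
      = (fps_const c * fps_binomial c) oo (g - 1)" by simp
  then have "g * (fps_deriv (fps_binomial c) oo (g - 1)) = fps_const c * B"
    by (simp add: fps_compose_mult_distrib[OF g1] fps_compose_add_distrib X B_def fps_cpower_def)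
  moreover have "fps_deriv B = (fps_deriv (fps_binomial c) oo (g - 1)) * fps_deriv g"
    unfolding B_def fps_cpower_def using fps_compose_deriv[OF g1] by simp
  ultimately have B': "g * fps_deriv B = fps_const c * B * fps_deriv g"
    by (simp add: mult.assoc[symmetric])
  have G': "fps_deriv G = - (G * fps_deriv L)"
    unfolding G_def fps_compose_deriv[OF L0] fps_exp_deriv
    by (simp add: fps_compose_mult_distrib[OF L0] fps_compose_uminus flip: fps_const_neg)
  have "g * fps_deriv (B * G) = (g * fps_deriv B) * G - B * G * (fps_deriv L * g)"
    by (simp add: G' algebra_simps)
  also have "\<dots> = 0" unfolding B' ode by (simp add: algebra_simps)
  finally have "fps_deriv (B * G) = 0" using g0 by auto
  then have "B * G = fps_const (fps_nth (B * G) 0)" by (simp only: fps_deriv_eq_0_iff)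
  then have BG: "B * G = 1" by (simp add: B_def G_def fps_cpower_def)
  have "G * (fps_exp 1 oo L) = (fps_exp (- 1) * fps_exp 1) oo L"
    by (simp add: G_def fps_compose_mult_distrib[OF L0])
  also have "\<dots> = 1" by (simp flip: fps_exp_add_mult)
  finally have "B * G * (fps_exp 1 oo L) = B" by (simp add: mult.assoc)
  with BG show ?thesis by (simp add: B_def)
qed

lemma neg_fps_exp_power:
  "(- fps_exp c) ^ n = fps_const ((- 1) ^ n) * fps_exp (of_nat n * c :: complex)"
proof -
  have "(- 1 :: complex fps) = fps_const (- 1)" by (simp flip: fps_const_neg)
  then show ?thesis
    unfolding power_minus[of "fps_exp c"] fps_exp_power_mult by (simp only: fps_const_power)
qed

lemma inverse_neg_fps_exp: "inverse (- fps_exp c) = - fps_exp (- c :: complex)"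
  by (simp add: fps_exp_neg)

lemma neg_fps_exp_powi:
  "(- fps_exp c) powi m = fps_const ((- 1) powi m) * fps_exp (of_int m * c :: complex)"
proof (cases "m \<ge> 0")
  case True
  then show ?thesis by (simp add: power_int_def neg_fps_exp_power)
next
  case False
  then show ?thesis
    unfolding power_int_def inverse_neg_fps_exp neg_fps_exp_power by simp
qed

text \<open>The logarithm of \<open>(1 - x) / (1 + x)\<close> is \<open>- 2\<close> times the sum of \<open>x^n / n\<close> over odd \<open>n\<close>.\<close>

lemma z_factor_eq_exp:
  "z_factor k = fps_exp 1 oo Abs_fps (\<lambda>n. if odd n then - (4 / k) / of_nat n else 0)"
proof -
  define L :: "complex fps" where "L = Abs_fps (\<lambda>n. if odd n then - (4 / k) / of_nat n else 0)"
  define g :: "complex fps" where "g = (1 - fps_X) / (1 + fps_X)"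
  have gX: "g * (1 + fps_X) = 1 - fps_X"
    by (simp add: g_def fps_divide_unit mult.assoc inverse_mult_eq_1)
  from arg_cong[OF this, of fps_deriv]
  have g': "fps_deriv g * (1 + fps_X) = - 1 - g" by (simp add: algebra_simps)
  have L': "fps_deriv L * ((1 - fps_X) * (1 + fps_X)) = fps_const (- (4 / k))"
  proof -
    have "fps_deriv L * ((1 - fps_X) * (1 + fps_X)) = fps_deriv L - fps_X ^ 2 * fps_deriv L"
      by (simp add: algebra_simps power2_eq_square)
    also have "\<dots> = fps_const (- (4 / k))"
    proof (rule fps_ext)
      fix n
      have nz: "complex_of_nat (Suc m) \<noteq> 0" for m by (rule of_nat_neq_0)
      have c: "fps_nth (fps_deriv L) m = (if even m then - (4 / k) else 0)" for m
        using nz[of m] by (simp add: L_def del: of_nat_Suc)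
      show "fps_nth (fps_deriv L - fps_X ^ 2 * fps_deriv L) n = fps_nth (fps_const (- (4 / k))) n"
        by (cases "n = 0 \<or> n = 1") (auto simp: fps_X_power_mult_nth c simp del: fps_deriv_nth)
    qed
    finally show ?thesis .
  qed
  have "(fps_deriv L * g) * (1 + fps_X) ^ 2 = fps_deriv L * ((g * (1 + fps_X)) * (1 + fps_X))"
    by (simp add: power2_eq_square mult_ac)
  also have "\<dots> = fps_const (- (4 / k))" unfolding gX L' ..
  also have "\<dots> = fps_const (2 / k) * - 2"
    by (simp add: numeral_fps_const flip: fps_const_neg)
  also have "- 2 = - (1 + fps_X) - g * (1 + fps_X)" unfolding gX by simp
  also have "\<dots> = (fps_deriv g * (1 + fps_X)) * (1 + fps_X)" unfolding g' by (simp add: algebra_simps)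
  finally have "(fps_deriv L * g) * (1 + fps_X) ^ 2
      = (fps_const (2 / k) * fps_deriv g) * (1 + fps_X) ^ 2"
    by (simp add: power2_eq_square mult_ac)
  moreover have "(1 + fps_X :: complex fps) ^ 2 \<noteq> 0"
  proof -
    have "fps_nth (1 + fps_X :: complex fps) 0 \<noteq> 0" by simp
    then show ?thesis by (metis fps_zero_nth power_not_zero)
  qed
  ultimately have "fps_deriv L * g = fps_const (2 / k) * fps_deriv g"
    using mult_right_cancel by blast
  then show ?thesis
    using fps_exp_compose_eq_fps_cpower[of g L "2 / k"]
    by (simp add: z_factor_def g_def L_def)
qed

section \<open>The structure series and the central term as \<open>h\<close> tends to zero\<close>

context
  fixes k :: complex and q t :: "complex fps"
  assumes k: "k \<noteq> 0" and q: "q = fps_exp 1" and t: "t = - fps_exp ((k + 2) / 2)"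
begin

lemma inverse_t: "inverse t = - fps_exp (- ((k + 2) / 2))"
  unfolding t by (rule inverse_neg_fps_exp)

lemma q_div_t: "q / t = - fps_exp (- (k / 2))"
proof -
  have "q / t = q * inverse t" unfolding t by (rule fps_divide_unit) simp
  also have "\<dots> = - (fps_exp 1 * fps_exp (- ((k + 2) / 2)))" unfolding inverse_t q by simp
  also have "\<dots> = - fps_exp (- (k / 2))"
    unfolding fps_exp_add_mult[symmetric] by (simp add: field_simps)
  finally show ?thesis .
qed

text \<open>
  For even \<open>n\<close> the constant terms of numerator and denominator already determine the value;
  for odd \<open>n\<close> both vanish and the linear terms are compared.
\<close>

lemma dv_quotient_at_h_zero:
  assumes "n \<ge> 1"
  shows "fps_nth ((1 - q ^ n) * (1 - inverse t ^ n) / (1 + (q / t) ^ n)) 0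
    = (if odd n then - (4 / k) else 0)"
proof -
  define N where "N = (1 - q ^ n) * (1 - inverse t ^ n)"
  define D where "D = 1 + (q / t) ^ n"
  have "D dvd N"
    using dv_quotient_exact[OF k assms] by (simp add: N_def D_def q t)
  then have "N = D * (N / D)" by simp
  then have e0: "fps_nth N 0 = fps_nth D 0 * fps_nth (N / D) 0"
    and e1: "fps_nth N 1 = fps_nth D 0 * fps_nth (N / D) 1 + fps_nth D 1 * fps_nth (N / D) 0"
    by (metis fps_mult_nth_0, metis fps_mult_nth_1)
  have N: "fps_nth N 0 = 0" "fps_nth N 1 = - of_nat n * (1 - (- 1) ^ n)"
    by (simp_all add: N_def q inverse_t neg_fps_exp_power fps_exp_power_mult)
  have D: "fps_nth D 0 = 1 + (- 1) ^ n" "fps_nth D 1 = - ((- 1) ^ n) * (of_nat n * (k / 2))"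
    by (simp_all add: D_def q_div_t neg_fps_exp_power)
  have "fps_nth (N / D) 0 = (if odd n then - (4 / k) else 0)"
  proof (cases "odd n")
    case True
    then have "fps_nth D 0 = 0" "fps_nth D 1 = of_nat n * (k / 2)" "fps_nth N 1 = - of_nat n * 2"
      unfolding D N by simp_all
    with e1 have "- of_nat n * 2 = of_nat n * (k / 2) * fps_nth (N / D) 0"
      by (simp only: mult_zero_left add_0)
    then have "of_nat n * (k * fps_nth (N / D) 0) = of_nat n * (- 4)"
      by (simp add: field_simps)
    then have "k * fps_nth (N / D) 0 = - 4"
      using assms by (simp only: mult_left_cancel of_nat_eq_0_iff)
    with True k show ?thesis by (simp add: field_simps)
  next
    case False
    with e0 N D show ?thesis by simp
  qed
  then show ?thesis by (simp only: N_def D_def)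
qed

lemma dv_f_at_h_zero: "fps_nth (fps_nth (dv_f q t) l) 0 = fps_nth (z_factor k) l"
proof -
  have "fps_nth (if n = 0 then 0 else fps_const (1 / of_nat n) *
          ((1 - q ^ n) * (1 - inverse t ^ n) / (1 + (q / t) ^ n))) 0
      = (if odd n then - (4 / k) / of_nat n else 0)" for n
    using dv_quotient_at_h_zero[of n] by (cases "n = 0") (simp_all del: fps_divide_nth_0)
  then show ?thesis
    by (simp add: dv_f_def Let_def fps_nth_nth_exp_series_0 z_factor_eq_exp)
qed

lemma dv_rhs_order_2:
  "fps_nth (dv_rhs q t a b) 2 = - (k * at_ratio (dilate (- 1) (euler_D delta)) a b)"
proof -
  define E where "E = (1 - q) * (1 - inverse t) / (1 - q / t)"
  define P where "P = at_ratio (dilate (q / t) delta) a b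
    - at_ratio (dilate (inverse (q / t)) delta) a b"
  have "E = (1 - q) * (1 - inverse t) * inverse (1 - q / t)"
    unfolding E_def by (rule fps_divide_unit) (simp add: q_div_t)
  then have E: "fps_nth E 0 = 0" "fps_nth E 1 = - 1"
    unfolding q_div_t unfolding inverse_t unfolding q by simp_all
  have ip: "inverse (q / t) = - fps_exp (k / 2)" unfolding q_div_t inverse_neg_fps_exp by simp
  have P: "fps_nth P 0 = 0"
    "fps_nth P 1 = - (k * at_ratio (dilate (- 1) (euler_D delta)) a b)"
    unfolding P_def ip
    by (simp_all add: q_div_t at_ratio_def dilate_def delta_def euler_D_def neg_fps_exp_powi)
  have "dv_rhs q t a b = - E * P" by (simp add: dv_rhs_def E_def P_def Let_def)
  moreover have "{0..2::nat} = {0, 1, 2}" by auto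
  ultimately show ?thesis using E P by (simp add: fps_mult_nth)
qed

end

section \<open>The relation at second order\<close>

lemma fps_nth_current_product:
  assumes "vector_space scale"
    and lin: "\<And>i n. i \<ge> 1 \<Longrightarrow> Vector_Spaces.linear scale scale (Tc i n)"
    and ex: "h_expansion T Tc"
  shows "fps_nth (T m (T n (fps_const v))) 0 = 0" "fps_nth (T m (T n (fps_const v))) 1 = 0"
    "fps_nth (T m (T n (fps_const v))) 2 = Tc 1 m (Tc 1 n v)"
proof -
  have z0: "Tc i n 0 = 0" if "i \<ge> 1" for i n
    by (rule module_hom.zero[OF Vector_Spaces.linear.axioms(3)[OF lin[OF that]]])
  have T: "fps_nth (T n w) N = (\<Sum>i=1..N. Tc i n (fps_nth w (N - i)))" for n w N
    using ex unfolding h_expansion_def by simp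
  have "{1..2::nat} = {1, 2}" by auto
  then show "fps_nth (T m (T n (fps_const v))) 0 = 0" "fps_nth (T m (T n (fps_const v))) 1 = 0"
    "fps_nth (T m (T n (fps_const v))) 2 = Tc 1 m (Tc 1 n v)"
    by (simp_all add: T z0)
qed

lemma fps_nth_dv_lhs_2:
  assumes "vector_space scale"
    and lin: "\<And>i n. i \<ge> 1 \<Longrightarrow> Vector_Spaces.linear scale scale (Tc i n)"
    and ex: "h_expansion T Tc"
    and f0: "\<And>l. fps_nth (fps_nth (dv_f q t) l) 0 = fps_nth g l"
  shows "fps_nth (dv_lhs scale q t T a b (fps_const v)) 2 =
    z_product scale g (Tc 1) a b v - z_product scale g (Tc 1) b a v"
proof -
  interpret vector_space scale by fact
  have "{0..2::nat} = {0, 1, 2}" by auto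
  then have "fps_nth (dv_product scale (dv_f q t) T a b (fps_const v)) 2
      = z_product scale g (Tc 1) a b v" for a b
    using fps_nth_current_product[OF assms(1) lin ex]
    by (simp add: dv_product_def hsum_def hscale_def z_product_def f0)
  then show ?thesis by (simp add: dv_lhs_def)
qed

lemma z_product_rescale:
  assumes "vector_space scale" and lin: "\<And>n. Vector_Spaces.linear scale scale (A n)"
    and z: "\<And>n v. z n v = scale \<i> (A n v)"
  shows "z_product scale g z a b v = - z_product scale g A a b v"
proof -
  interpret vector_space scale by fact
  have sc: "A n (scale c v) = scale c (A n v)" for n c v
    by (rule module_hom.scale[OF Vector_Spaces.linear.axioms(3)[OF lin]])
  have "z m (z n v) = - A m (A n v)" for m n v by (simp add: z sc)
  then show ?thesis
    by (simp add: z_product_def scale_minus_right Sum_any.expand_set sum_negf)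
qed

theorem mainTheorem2:
  fixes scale :: "complex \<Rightarrow> 'v::ab_group_add \<Rightarrow> 'v"
    and k :: complex
    and q t :: "complex fps"
    and T :: "int \<Rightarrow> 'v fps \<Rightarrow> 'v fps"
    and Tc :: "nat \<Rightarrow> int \<Rightarrow> 'v \<Rightarrow> 'v"
    and z :: "int \<Rightarrow> 'v \<Rightarrow> 'v"
  assumes "vector_space scale"
    and "k \<noteq> 0" and "k \<noteq> - 2"
    and "q = fps_exp 1" and "t = - fps_exp ((k + 2) / 2)"
    and "\<And>i n. i \<ge> 1 \<Longrightarrow> Vector_Spaces.linear scale scale (Tc i n)"
    and "\<And>i. i \<ge> 1 \<Longrightarrow> smooth (Tc i)"
    and "h_expansion T Tc"
    and "\<And>n v. z n v = scale \<i> (Tc 1 n v)"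
  shows "(deformed_virasoro_at_order 2 scale q t T \<longleftrightarrow> z_algebra_relation scale k z) \<and>
         (deformed_virasoro scale q t T \<longrightarrow> z_algebra_relation scale k z)"
proof -
  interpret vector_space scale by fact
  note kqt = assms(2,4,5)
  define d where "d a b = k * at_ratio (dilate (- 1) (euler_D delta)) a b" for a b
  have lhs: "fps_nth (dv_lhs scale q t T a b (fps_const v)) 2 =
      z_product scale (z_factor k) (Tc 1) a b v - z_product scale (z_factor k) (Tc 1) b a v"
    for a b v
    by (rule fps_nth_dv_lhs_2[OF assms(1,6,8) dv_f_at_h_zero[OF kqt]])
  have "{0..2::nat} = {0, 1, 2}" by auto
  then have rhs: "fps_nth (hscale scale (dv_rhs q t a b) (fps_const v)) 2 = - scale (d a b) v"
    for a b v
    by (simp add: hscale_def dv_rhs_order_2[OF kqt] d_def scale_minus_left)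
  have zz: "z_product scale (z_factor k) z a b v = - z_product scale (z_factor k) (Tc 1) a b v"
    for a b v
    by (rule z_product_rescale[OF assms(1) assms(6) assms(9)]) simp
  have neg: "x - y = - s \<longleftrightarrow> - x = - y + s" for x y s :: 'v
  proof -
    have "x - y = - s \<longleftrightarrow> - (x - y) = s" by (subst minus_equation_iff) (rule eq_commute)
    also have "\<dots> \<longleftrightarrow> - x = - y + s" by (auto simp: algebra_simps)
    finally show ?thesis .
  qed
  have iff: "deformed_virasoro_at_order 2 scale q t T \<longleftrightarrow> z_algebra_relation scale k z"
    unfolding deformed_virasoro_at_order_def z_algebra_relation_def lhs rhs zz d_def[symmetric] neg
    ..
  have "deformed_virasoro scale q t T \<Longrightarrow> deformed_virasoro_at_order 2 scale q t T"
    by (simp add: deformed_virasoro_def deformed_virasoro_at_order_def)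
  with iff show ?thesis by blast
qed

end
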